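(* Every regular partially ordered Banach space $(X,\|\cdot\|,\succcurlyeq)$ has the bi-chain-complete property.
   Context: For a partial order $\succcurlyeq$ on $X$ write $[u)=\{x\in X: x\succcurlyeq u\}$, $(w]=\{x\in X: x\preccurlyeq w\}$ and $[u,w]=[u)\cap(w]$. A partially ordered Banach space $(X,\|\cdot\|,\succcurlyeq)$ is a real Banach space $X$ with a partial order $\succcurlyeq$ such that: (1) $x\succcurlyeq y$ implies $x+z\succcurlyeq y+z$ for all $x,y,z\in X$; (2) $x\succcurlyeq y$ implies $\alpha x\succcurlyeq\alpha y$ for all $x,y\in X$ and $\alpha\ge 0$; (3) there are distinct $x,y\in X$ with $x\succcurlyeq y$; and for every $u\in X$ the sets $[u)$ and $(u]$ are norm-closed. It is called regular if every $\succcurlyeq$-increasing sequence that has a $\succcurlyeq$-upper bound in $X$ is norm-convergent, i.e. $x_1\preccurlyeq x_2\preccurlyeq\cdots\preccurlyeq y$ for some $y\in X$ implies that there is $x\in X$ with $\|x_n-x\|\to 0$. A chain is a nonempty totally ordered subset. A subset $D$ is bi-chain-complete if every chain in $D$ has both the smallest $\succcurlyeq$-upper bound and the greatest $\succcurlyeq$-lower bound in $D$. A poset $(X,\succcurlyeq)$ has the bi-chain-complete property if every interval $[u,w]$ (with $u,w\in X$) is bi-chain-complete. *)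

theory Defs
  imports Complex_Main "HOL-Library.Lub_Glb"
begin

text \<open>
  The compatibility of the order with addition and with multiplication by nonnegative scalars
  is \<^class>\<open>ordered_real_vector\<close>; its axiom \<open>scaleR_right_mono\<close> follows from the others.
  No relation between the order and the norm is assumed beyond closedness of the half-lines.
\<close>

class partially_ordered_banach = banach + ordered_real_vector +
  assumes ex_distinct_comparable: "\<exists>x y. x \<noteq> y \<and> x \<ge> y"
    and closed_atLeast_norm: "closed {u..}"
    and closed_atMost_norm: "closed {..u}"

definition regular_partially_ordered :: "'a::partially_ordered_banach itself \<Rightarrow> bool" where
  "regular_partially_ordered (_ :: 'a itself) \<longleftrightarrow>
     (\<forall>x :: nat \<Rightarrow> 'a. incseq x \<and> (\<exists>y. \<forall>n. x n \<le> y) \<longrightarrow> convergent x)"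

text \<open>
  The bounds are the supremum and infimum in the whole poset (hence \<^term>\<open>UNIV\<close>), which are
  moreover required to lie in \<open>D\<close>. This implies that they are also the least upper and
  greatest lower bound among the elements of \<open>D\<close>. Chains are nonempty, whereas
  \<^const>\<open>Complete_Partial_Order.chain\<close> admits the empty set.
\<close>

definition bi_chain_complete :: "'a::order set \<Rightarrow> bool" where
  "bi_chain_complete D \<longleftrightarrow>
     (\<forall>C \<subseteq> D. C \<noteq> {} \<and> Complete_Partial_Order.chain (\<le>) C \<longrightarrow>
        (\<exists>s\<in>D. isLub UNIV C s) \<and> (\<exists>i\<in>D. isGlb UNIV C i))"

definition bi_chain_complete_property :: "'a::order itself \<Rightarrow> bool" where
  "bi_chain_complete_property (_ :: 'a itself) \<longleftrightarrow> (\<forall>u w :: 'a. bi_chain_complete {u..w})"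

end

theory Submission imports Defs begin

text \<open>
  Along a chain in an order interval, regularity forces arbitrarily small oscillation above suitable
  elements, since otherwise some increasing sequence in the chain would have infinitely many
  jumps of a fixed size. An increasing sequence in the chain whose oscillations tend to 0 converges
  to the supremum: an element of the chain that lies above the whole sequence must equal its limit.
  Infima follow by the reflection \<open>x \<mapsto> -x\<close>.
\<close>

lemma chain_small_oscillation:
  fixes C :: "'a::partially_ordered_banach set"
  assumes reg: "regular_partially_ordered TYPE('a)"
    and bdd: "\<And>c. c \<in> C \<Longrightarrow> c \<le> w"
    and "x \<in> C" "e > 0"
  shows "\<exists>c\<in>C. x \<le> c \<and> (\<forall>d\<in>C. c \<le> d \<longrightarrow> norm (d - c) < e)"
proof (rule ccontr)
  assume contra: "\<not> ?thesis"
  \<comment> \<open>The invariant \<open>x \<le> f n\<close> lets the negated claim supply each next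
    element. The jumps of size at least \<open>e\<close> will contradict the Cauchy
    property.\<close>
  have "\<exists>f. \<forall>n. (f n \<in> C \<and> x \<le> f n) \<and> (f n \<le> f (Suc n) \<and> e \<le> norm (f (Suc n) - f n))"
  proof (rule dependent_nat_choice)
    show "\<exists>c. c \<in> C \<and> x \<le> c" using \<open>x \<in> C\<close> by blast
  next
    fix c :: 'a and n :: nat
    assume "c \<in> C \<and> x \<le> c"
    with contra show "\<exists>d. (d \<in> C \<and> x \<le> d) \<and> (c \<le> d \<and> e \<le> norm (d - c))"
      by (meson not_less order_trans)
  qed
  then obtain f where f: "\<And>n. f n \<in> C" "\<And>n. f n \<le> f (Suc n)"
      "\<And>n. e \<le> norm (f (Suc n) - f n)" by blast
  have "incseq f" using f(2) by (rule incseq_SucI)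
  moreover have "\<exists>y. \<forall>n. f n \<le> y" using f(1) bdd by blast
  ultimately have "convergent f"
    using reg unfolding regular_partially_ordered_def by blast
  then have "Cauchy f" by (rule convergent_Cauchy)
  then obtain N where "\<forall>m\<ge>N. \<forall>n\<ge>N. norm (f m - f n) < e"
    using \<open>e > 0\<close> unfolding Cauchy_iff by blast
  then have "norm (f (Suc N) - f N) < e" by simp
  with f(3)[of N] show False by simp
qed

lemma chain_in_interval_has_Lub:
  fixes C :: "'a::partially_ordered_banach set"
  assumes reg: "regular_partially_ordered TYPE('a)"
    and C: "C \<subseteq> {u..w}" "C \<noteq> {}" "Complete_Partial_Order.chain (\<le>) C"
  shows "\<exists>s\<in>{u..w}. isLub UNIV C s"
proof -
  have bdd: "\<And>c. c \<in> C \<Longrightarrow> c \<le> w" using C(1) by auto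
  \<comment> \<open>\<open>P n c\<close> bounds the oscillation of \<open>C\<close> above
    \<open>c\<close>; the successor keeps the bound positive and finite at
    \<open>n = 0\<close>.\<close>
  define P where "P n c \<longleftrightarrow> c \<in> C \<and> (\<forall>d\<in>C. c \<le> d \<longrightarrow> norm (d - c) < inverse (real (Suc n)))"
    for n c
  have step: "\<exists>c. P n c \<and> x \<le> c" if "x \<in> C" for n x
    using chain_small_oscillation[OF reg bdd that, of "inverse (real (Suc n))"]
    unfolding P_def by auto
  have "\<exists>f. \<forall>n. P n (f n) \<and> f n \<le> f (Suc n)"
  proof (rule dependent_nat_choice)
    show "\<exists>c. P 0 c" using step C(2) by blast
    show "\<exists>d. P (Suc n) d \<and> c \<le> d" if "P n c" for c n
      using that step unfolding P_def by blast
  qed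
  then obtain f where f: "\<And>n. P n (f n)" "\<And>n. f n \<le> f (Suc n)" by blast
  have fC: "f n \<in> C" for n using f(1) unfolding P_def by blast
  have inc: "incseq f" using f(2) by (rule incseq_SucI)
  moreover have "\<exists>y. \<forall>n. f n \<le> y" using fC bdd by blast
  ultimately have "convergent f"
    using reg unfolding regular_partially_ordered_def by blast
  then obtain s where s: "f \<longlonglongrightarrow> s" unfolding convergent_def by blast
  have le_s: "f n \<le> s" for n
  proof -
    \<comment> \<open>The tail of \<open>f\<close> from index \<open>n\<close> on lies in a closed
      half-line, which therefore contains the limit.\<close>
    have "eventually (\<lambda>m. f m \<in> {f n..}) sequentially"
      using eventually_ge_at_top[of n] by eventually_elim (use inc in \<open>auto dest: incseqD\<close>)
    then show ?thesis
      using Lim_in_closed_set[OF closed_atLeast_norm _ _ s, of "f n"] by simp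
  qed
  \<comment> \<open>Used twice: with \<open>b = w\<close> to place \<open>s\<close> in the interval,
    and with arbitrary \<open>b\<close> to show that \<open>s\<close> is the least upper
    bound.\<close>
  have s_le: "s \<le> b" if "\<And>c. c \<in> C \<Longrightarrow> c \<le> b" for b
    using Lim_in_closed_set[OF closed_atMost_norm _ _ s, of b] that fC by simp
  have upper: "d \<le> s" if "d \<in> C" for d
  proof (cases "\<exists>n. d \<le> f n")
    case True
    then show ?thesis using le_s order_trans by blast
  next
    case False
    \<comment> \<open>By totality, \<open>d\<close> lies above every \<open>f n\<close>, so
      \<open>P n (f n)\<close> puts it within \<open>1/(n+1)\<close> of \<open>f n\<close>. Hence
      \<open>f\<close> also converges to \<open>d\<close>.\<close>
    then have "f n \<le> d" for n
      using C(3) fC \<open>d \<in> C\<close> unfolding chain_def by blast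
    then have "norm (f n - d) < inverse (real (Suc n))" for n
      using f(1)[of n] \<open>d \<in> C\<close> unfolding P_def by (simp add: norm_minus_commute)
    then have "(\<lambda>n. norm (f n - d)) \<longlonglongrightarrow> 0"
      by (intro tendsto_sandwich[OF _ _ tendsto_const LIMSEQ_inverse_real_of_nat])
        (simp_all add: less_imp_le del: of_nat_Suc)
    then have "f \<longlonglongrightarrow> d" by (simp add: tendsto_norm_zero_iff LIM_zero_iff)
    with s have "s = d" by (rule LIMSEQ_unique)
    then show ?thesis by simp
  qed
  have "s \<in> {u..w}"
    using s_le[OF bdd] order_trans[OF _ le_s[of 0]] fC[of 0] C(1) by auto
  moreover have "isLub UNIV C s"
    using upper s_le by (auto simp: isLub_def leastP_def isUb_def setle_def setge_def)
  ultimately show ?thesis by blast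
qed

lemma isGlb_uminus_if_isLub:
  fixes C :: "'a::ordered_ab_group_add set"
  assumes "isLub UNIV (uminus ` C) s"
  shows "isGlb UNIV C (- s)"
  using assms
  by (auto simp: isLub_def leastP_def isUb_def isGlb_def greatestP_def isLb_def setle_def setge_def
      minus_le_iff le_minus_iff)
    (metis le_minus_iff minus_minus)

theorem corollary3p4:
  assumes "regular_partially_ordered TYPE('a::partially_ordered_banach)"
  shows "bi_chain_complete_property TYPE('a)"
  unfolding bi_chain_complete_property_def bi_chain_complete_def
proof (intro allI impI conjI; elim conjE)
  fix u w :: 'a and C
  assume C: "C \<subseteq> {u..w}" "C \<noteq> {}" "Complete_Partial_Order.chain (\<le>) C"
  show "\<exists>s\<in>{u..w}. isLub UNIV C s"
    using chain_in_interval_has_Lub[OF assms C] .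
  \<comment> \<open>The reflected set is again a nonempty chain in an interval, with the endpoints
    swapped, so its supremum is available.\<close>
  have "uminus ` C \<subseteq> {- w..- u}" "uminus ` C \<noteq> {}" using C by auto
  moreover have "Complete_Partial_Order.chain (\<le>) (uminus ` C)"
    using C(3) unfolding chain_def by auto
  ultimately obtain s where "s \<in> {- w..- u}" "isLub UNIV (uminus ` C) s"
    using chain_in_interval_has_Lub[OF assms] by blast
  then show "\<exists>i\<in>{u..w}. isGlb UNIV C i"
    by (intro bexI[of _ "- s"] isGlb_uminus_if_isLub) (auto simp: minus_le_iff le_minus_iff)
qed

end
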